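(* Let $\mathbf{A} \in \mathsf{CIdInRL}$ and $x \in A$. Then $\langle B_x, \cdot, \vee, -, 0_x, 1_x \rangle$ is a Boolean algebra (with meet $\cdot$, join $\vee$, complement $-$, bottom $0_x$ and top $1_x$).
   Context: A commutative idempotent involutive residuated lattice is an algebra $\mathbf{A}=\langle A,\wedge,\vee,\cdot,\to,1,0\rangle$ such that $\langle A,\wedge,\vee\rangle$ is a lattice (with lattice order $\leq$), $\langle A,\cdot,1\rangle$ is a commutative monoid with $x\cdot x=x$ for all $x$, residuation holds ($x\cdot y\leq z \iff y\leq x\to z$), and, writing $-x := x\to 0$, one has $-{-}x=x$ for all $x$. The class of these algebras is $\mathsf{CIdInRL}$. The monoidal order is $x\sqsubseteq y :\Leftrightarrow x\cdot y=x$. For $x\in A$ put $1_x := x\vee -x$, $0_x := x\wedge -x$, and $B_x := \{y\in A \mid 0_x\sqsubseteq y\sqsubseteq 1_x\}$. One-element Boolean algebras are allowed. *)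

theory Defs
  imports Main
begin

class cidinrl = lattice + comm_monoid_mult + zero +
  fixes residual :: "'a \<Rightarrow> 'a \<Rightarrow> 'a"  (infixr "\<rightarrow>" 60)
  assumes mult_idem: "x * x = x"
    and residuation: "x * y \<le> z \<longleftrightarrow> y \<le> x \<rightarrow> z"
    and involutive: "(x \<rightarrow> 0) \<rightarrow> 0 = x"
begin

definition neg :: "'a \<Rightarrow> 'a" where
  "neg x = x \<rightarrow> 0"

definition monoidal_le :: "'a \<Rightarrow> 'a \<Rightarrow> bool"  (infix "\<sqsubseteq>" 50) where
  "x \<sqsubseteq> y \<longleftrightarrow> x * y = x"

definition one_at :: "'a \<Rightarrow> 'a" where
  "one_at x = sup x (neg x)"

definition zero_at :: "'a \<Rightarrow> 'a" where
  "zero_at x = inf x (neg x)"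

definition B_at :: "'a \<Rightarrow> 'a set" where
  "B_at x = {y. zero_at x \<sqsubseteq> y \<and> y \<sqsubseteq> one_at x}"

end

text \<open>
  The relativisation to a carrier set of the library's type-based locale
  \<open>abstract_boolean_algebra\<close>. As there, \<open>bt = tp\<close> is allowed.
\<close>

locale boolean_algebra_on =
  fixes C :: "'a set"
    and meet :: "'a \<Rightarrow> 'a \<Rightarrow> 'a"
    and join :: "'a \<Rightarrow> 'a \<Rightarrow> 'a"
    and compl :: "'a \<Rightarrow> 'a"
    and bt :: 'a
    and tp :: 'a
  assumes meet_closed: "\<lbrakk>a \<in> C; b \<in> C\<rbrakk> \<Longrightarrow> meet a b \<in> C"
    and join_closed: "\<lbrakk>a \<in> C; b \<in> C\<rbrakk> \<Longrightarrow> join a b \<in> C"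
    and compl_closed: "a \<in> C \<Longrightarrow> compl a \<in> C"
    and bt_closed: "bt \<in> C"
    and tp_closed: "tp \<in> C"
    and meet_assoc: "\<lbrakk>a \<in> C; b \<in> C; c \<in> C\<rbrakk> \<Longrightarrow> meet (meet a b) c = meet a (meet b c)"
    and meet_commute: "\<lbrakk>a \<in> C; b \<in> C\<rbrakk> \<Longrightarrow> meet a b = meet b a"
    and join_assoc: "\<lbrakk>a \<in> C; b \<in> C; c \<in> C\<rbrakk> \<Longrightarrow> join (join a b) c = join a (join b c)"
    and join_commute: "\<lbrakk>a \<in> C; b \<in> C\<rbrakk> \<Longrightarrow> join a b = join b a"
    and meet_join_distrib:
      "\<lbrakk>a \<in> C; b \<in> C; c \<in> C\<rbrakk> \<Longrightarrow> meet a (join b c) = join (meet a b) (meet a c)"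
    and join_meet_distrib:
      "\<lbrakk>a \<in> C; b \<in> C; c \<in> C\<rbrakk> \<Longrightarrow> join a (meet b c) = meet (join a b) (join a c)"
    and meet_tp: "a \<in> C \<Longrightarrow> meet a tp = a"
    and join_bt: "a \<in> C \<Longrightarrow> join a bt = a"
    and meet_compl: "a \<in> C \<Longrightarrow> meet a (compl a) = bt"
    and join_compl: "a \<in> C \<Longrightarrow> join a (compl a) = tp"

lemma boolean_algebra_on_UNIV:
  "boolean_algebra_on UNIV meet join compl bt tp
    \<longleftrightarrow> abstract_boolean_algebra meet join compl bt tp"
  unfolding boolean_algebra_on_def abstract_boolean_algebra_def
    abstract_boolean_algebra_axioms_def abel_semigroup_def
    abel_semigroup_axioms_def semigroup_def
  by auto

end

theory Submission
  imports Defs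
begin

text \<open>
  The element \<open>zero_at x = x * neg x\<close> determines the whole block: every
  \<open>y \<in> B_at x\<close> satisfies \<open>y * neg y = zero_at x\<close> and, dually,
  \<open>sup y (neg y) = one_at x\<close>. Hence \<open>zero_at x\<close> and \<open>one_at x\<close> are also the
  bounds of the block in the lattice order, so products lie below their factors there;
  this absorption turns distributivity of the product over joins, which holds by
  residuation, into the dual distributive law.
\<close>

context cidinrl
begin

lemma mult_le_zero_iff: "x * y \<le> 0 \<longleftrightarrow> y \<le> neg x"
  by (simp add: neg_def residuation)

lemma neg_neg [simp]: "neg (neg x) = x"
  by (simp add: neg_def involutive)

lemma mult_idem_left: "x * (x * y) = x * y"
  by (simp add: mult_idem flip: mult.assoc)

lemma mult_left_mono: "y \<le> z \<Longrightarrow> x * y \<le> x * z"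
  using residuation order_trans by blast

text \<open>By residuation, multiplication by \<open>x\<close> is a lower adjoint, so it preserves
  joins.\<close>

lemma mult_sup_distrib: "x * sup y z = sup (x * y) (x * z)"
proof (rule order.antisym)
  have "y \<le> x \<rightarrow> sup (x * y) (x * z)" "z \<le> x \<rightarrow> sup (x * y) (x * z)"
    by (simp_all flip: residuation)
  then show "x * sup y z \<le> sup (x * y) (x * z)"
    by (simp add: residuation)
  show "sup (x * y) (x * z) \<le> x * sup y z"
    by (simp add: mult_left_mono)
qed

lemma sup_mult_distrib: "sup y z * x = sup (y * x) (z * x)"
  by (simp only: mult.commute[of _ x] mult_sup_distrib)

text \<open>Both sides say that the product of \<open>x\<close> and \<open>y\<close> is below
  \<open>0\<close>, which is symmetric by commutativity. Together with \<open>neg_neg\<close>, this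
  makes \<open>neg\<close> an antitone involution and yields De Morgan.\<close>

lemma le_neg_iff: "y \<le> neg x \<longleftrightarrow> x \<le> neg y"
  by (simp add: mult.commute flip: mult_le_zero_iff)

lemma neg_le_iff: "neg x \<le> y \<longleftrightarrow> neg y \<le> x"
  using le_neg_iff[of "neg x" "neg y"] by simp

lemma neg_inf: "neg (inf x y) = sup (neg x) (neg y)"
proof (rule order.antisym)
  show "neg (inf x y) \<le> sup (neg x) (neg y)"
    by (subst neg_le_iff) (simp add: neg_le_iff[of _ x] neg_le_iff[of _ y])
  show "sup (neg x) (neg y) \<le> neg (inf x y)"
    by (simp add: neg_le_iff[of x] neg_le_iff[of y])
qed

lemma neg_zero_at: "neg (zero_at x) = one_at x"
  by (simp add: zero_at_def one_at_def neg_inf sup_commute)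

lemma zero_at_neg [simp]: "zero_at (neg x) = zero_at x"
  by (simp add: zero_at_def inf_commute)

lemma zero_at_eq_mult: "zero_at x = x * neg x"
proof (rule order.antisym)
  have "zero_at x * zero_at x \<le> x * zero_at x"
    using mult_left_mono[of "zero_at x" x "zero_at x"]
    by (simp add: zero_at_def mult.commute)
  also have "\<dots> \<le> x * neg x"
    by (rule mult_left_mono) (simp add: zero_at_def)
  finally show "zero_at x \<le> x * neg x"
    by (simp add: mult_idem)
  \<comment> \<open>Residuation reduces this to a product with one more factor \<open>x\<close>,
    which idempotence absorbs. The instance at \<open>neg x\<close> bounds the same product by
    \<open>x\<close>.\<close>
  have "x * neg x \<le> neg x" for x
  proof -
    have "x * (x * neg x) \<le> 0"
      by (simp add: mult_idem_left mult_le_zero_iff)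
    then show ?thesis
      by (simp only: mult_le_zero_iff)
  qed
  from this[of x] this[of "neg x"] show "x * neg x \<le> zero_at x"
    by (simp add: zero_at_def mult.commute)
qed

lemma zero_at_le_zero: "zero_at x \<le> 0"
  by (simp add: zero_at_eq_mult mult_le_zero_iff)

lemma mult_zero_at [simp]: "x * zero_at x = zero_at x"
  by (simp add: zero_at_eq_mult mult_idem_left)

text \<open>Distributing over the join leaves \<open>x\<close> joined with
  \<open>x * neg x = zero_at x\<close>, which lies below \<open>x\<close>.\<close>

lemma mult_one_at [simp]: "x * one_at x = x"
proof (rule order.antisym)
  have "x * one_at x = sup x (zero_at x)"
    by (simp add: one_at_def mult_sup_distrib mult_idem zero_at_eq_mult)
  then show "x * one_at x \<le> x" "x \<le> x * one_at x"
    by (simp_all add: zero_at_def)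
qed

lemma mem_B_at_iff: "y \<in> B_at x \<longleftrightarrow> y * zero_at x = zero_at x \<and> y * one_at x = y"
  by (simp add: B_at_def monoidal_le_def mult.commute)

lemma mem_B_at_self: "x \<in> B_at x"
  by (simp add: mem_B_at_iff)

lemma zero_at_eqI:
  assumes "y \<in> B_at x"
  shows "zero_at y = zero_at x"
proof -
  let ?a = "zero_at x"
  from assms have ya: "y * ?a = ?a" and ye: "y * neg ?a = y"
    by (simp_all add: mem_B_at_iff neg_zero_at)
  \<comment> \<open>Since \<open>neg ?a\<close> is \<open>one_at x\<close>, it fixes
    \<open>y\<close> and hence \<open>y * neg y\<close>, which is below \<open>0\<close>;
    residuation then moves \<open>neg ?a\<close> across.\<close>
  have "neg ?a * (y * neg y) = y * neg ?a * neg y"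
    by (simp only: ac_simps)
  then have "neg ?a * zero_at y = zero_at y"
    by (simp only: ye zero_at_eq_mult[of y])
  then have "neg ?a * zero_at y \<le> 0"
    using zero_at_le_zero[of y] by (simp only:)
  then have le: "zero_at y \<le> ?a"
    by (simp only: mult_le_zero_iff neg_neg)
  \<comment> \<open>Aiming at \<open>?a \<le> y\<close>, which means
    \<open>neg y * ?a \<le> 0\<close>: inserting a factor \<open>y\<close> next to \<open>?a\<close>
    exposes \<open>zero_at y\<close>, already bounded by \<open>?a\<close>.\<close>
  have "neg y * ?a = neg y * (y * ?a)"
    by (simp only: ya)
  also have "\<dots> = ?a * zero_at y"
    by (simp only: zero_at_eq_mult[of y] ac_simps)
  also have "\<dots> \<le> ?a * ?a"
    by (rule mult_left_mono) (rule le)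
  finally have "neg y * ?a \<le> 0"
    using zero_at_le_zero[of x] by (simp add: mult_idem)
  then have "?a \<le> y"
    by (simp add: mult_le_zero_iff)
  moreover have "?a \<le> neg y"
    using zero_at_le_zero[of x] by (simp add: ya flip: mult_le_zero_iff)
  ultimately show ?thesis
    using le by (simp add: zero_at_def order.antisym)
qed

text \<open>Blocks are the fibres of \<open>zero_at\<close>: each \<open>y\<close> lies in its own
  block, whose bounds depend only on \<open>zero_at y\<close>. Closure under \<open>neg\<close>
  follows because \<open>zero_at\<close> is invariant under it.\<close>

lemma mem_B_at_iff_zero_at: "y \<in> B_at x \<longleftrightarrow> zero_at y = zero_at x"
proof
  assume "zero_at y = zero_at x"
  then show "y \<in> B_at x"
    using mult_zero_at[of y] mult_one_at[of y]
    by (simp add: mem_B_at_iff flip: neg_zero_at)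
qed (rule zero_at_eqI)

lemma one_at_eqI: "y \<in> B_at x \<Longrightarrow> one_at y = one_at x"
  by (simp add: zero_at_eqI flip: neg_zero_at)

lemma neg_mem_B_at: "y \<in> B_at x \<Longrightarrow> neg y \<in> B_at x"
  by (simp add: mem_B_at_iff_zero_at)

lemma zero_at_le: "y \<in> B_at x \<Longrightarrow> zero_at x \<le> y"
  by (metis inf_le1 zero_at_def zero_at_eqI)

lemma le_one_at: "y \<in> B_at x \<Longrightarrow> y \<le> one_at x"
  by (metis one_at_def one_at_eqI sup_ge1)

lemma mult_mem_B_at: "y \<in> B_at x \<Longrightarrow> z \<in> B_at x \<Longrightarrow> y * z \<in> B_at x"
  by (simp add: mem_B_at_iff mult.assoc)

lemma sup_mem_B_at: "y \<in> B_at x \<Longrightarrow> z \<in> B_at x \<Longrightarrow> sup y z \<in> B_at x"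
  by (simp add: mem_B_at_iff sup_mult_distrib)

lemma zero_at_mem_B_at: "zero_at x \<in> B_at x"
  by (metis mem_B_at_self mult_mem_B_at neg_mem_B_at zero_at_eq_mult)

lemma one_at_mem_B_at: "one_at x \<in> B_at x"
  by (metis neg_mem_B_at neg_zero_at zero_at_mem_B_at)

text \<open>In the lattice order \<open>z\<close> is below \<open>one_at x\<close>, which acts as
  the unit on the block.\<close>

lemma mult_le_left:
  assumes "y \<in> B_at x" "z \<in> B_at x"
  shows "y * z \<le> y"
  using mult_left_mono[OF le_one_at[OF assms(2)], of y] assms(1)
  by (simp add: mem_B_at_iff)

lemma sup_mult_distrib_B_at:
  assumes "y \<in> B_at x" "z \<in> B_at x" "w \<in> B_at x"
  shows "sup y (z * w) = sup y z * sup y w"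
proof -
  \<comment> \<open>Multiplying out turns \<open>y * y\<close> into \<open>y\<close>, which then
    absorbs both mixed products.\<close>
  have "sup y z * sup y w = sup (sup (sup y (y * z)) (y * w)) (z * w)"
    by (simp add: mult_sup_distrib sup_mult_distrib mult_idem mult.commute[of z y] sup.assoc)
  also have "\<dots> = sup y (z * w)"
    using assms by (simp add: mult_le_left sup_absorb1)
  finally show ?thesis ..
qed

end

theorem theorem3p3:
  fixes x :: "'a::cidinrl"
  shows "boolean_algebra_on (B_at x) (*) sup neg (zero_at x) (one_at x)"
proof
  fix a b c :: 'a
  show "zero_at x \<in> B_at x" "one_at x \<in> B_at x"
    by (rule zero_at_mem_B_at one_at_mem_B_at)+
  show "a * b * c = a * (b * c)" "a * b = b * a"
    "sup (sup a b) c = sup a (sup b c)" "sup a b = sup b a"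
    "a * sup b c = sup (a * b) (a * c)"
    by (simp_all add: ac_simps mult_sup_distrib)
  assume a: "a \<in> B_at x"
  show "neg a \<in> B_at x"
    using a by (rule neg_mem_B_at)
  \<comment> \<open>The first law is the monoidal upper bound from membership; the second uses the
    lower bound in the lattice order.\<close>
  show "a * one_at x = a" "sup a (zero_at x) = a"
    using a zero_at_le[OF a] by (simp_all add: mem_B_at_iff sup_absorb1)
  show "a * neg a = zero_at x" "sup a (neg a) = one_at x"
    using zero_at_eqI[OF a] one_at_eqI[OF a]
    by (simp_all add: zero_at_eq_mult one_at_def)
  assume b: "b \<in> B_at x"
  show "a * b \<in> B_at x" "sup a b \<in> B_at x"
    using a b by (rule mult_mem_B_at sup_mem_B_at)+
  assume c: "c \<in> B_at x"
  show "sup a (b * c) = sup a b * sup a c"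
    using a b c by (rule sup_mult_distrib_B_at)
qed

end
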